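(* Let $B$ be a bounded skew-symmetric invertible operator on a real Hilbert space $H$. Then there exist a real Hilbert space $K$, a positive invertible operator $P$ on $K$, and a real orthogonal transformation $V \colon H \to K \oplus K$ such that $$B = V^{T} \begin{bmatrix} 0 & -P \\ P & 0 \end{bmatrix} V.$$
   Context: All operators are bounded and real-linear. For a bounded operator $A\colon H_1\to H_2$ between real Hilbert spaces, the transpose $A^{T}\colon H_2\to H_1$ is the unique bounded operator with $\langle Ax, y\rangle = \langle x, A^{T}y\rangle$ for all $x\in H_1$, $y\in H_2$. $B$ is skew-symmetric if $B^{T} = -B$. An operator $P$ on $K$ is positive if $P^{T}=P$ and $\langle x, Px\rangle \ge 0$ for all $x \in K$. Invertible means having a bounded inverse. An orthogonal transformation $V\colon H\to K\oplus K$ is a bounded operator with $V^{T}V = I_H$ and $VV^{T} = I_{K\oplus K}$. The block matrix acts on the Hilbert space direct sum $K\oplus K$ by $(x,y)\mapsto(-Py,Px)$. *)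

theory Defs
  imports "HOL-Analysis.Analysis"
begin

text \<open>
  Hilbert spaces are represented by carrier sets: a complete linear subspace of an inner product
  space, with the inherited operations. A type of sort \<open>{real_inner, banach}\<close> is the case
  \<open>UNIV\<close>, and the Hilbert space direct sum of \<open>S\<close> and \<open>T\<close> is \<open>S \<times> T\<close>, since the inner product of
  the library on pairs is \<open>(x, y) \<bullet> (x', y') = x \<bullet> x' + y \<bullet> y'\<close>.
  Operators are functions of which only the values on the carrier are meaningful, so that
  equality of operators on \<open>S\<close> means equality at all points of \<open>S\<close>.
  Carriers make it possible to assert the existence of a Hilbert space, which types do not. A space
  \<open>K\<close> with \<open>K \<oplus> K\<close> isometric to \<open>H\<close> is isometric to a closed subspace of \<open>H\<close>, so it is no
  restriction to look for it among the carriers in the type of \<open>H\<close>.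
\<close>

definition real_hilbert_space :: "'a::real_inner set \<Rightarrow> bool" where
  "real_hilbert_space S \<longleftrightarrow> subspace S \<and> complete S"

definition bounded_operator :: "'a::real_inner set \<Rightarrow> 'b::real_inner set \<Rightarrow> ('a \<Rightarrow> 'b) \<Rightarrow> bool" where
  "bounded_operator S T A \<longleftrightarrow>
     (\<forall>x\<in>S. A x \<in> T) \<and>
     (\<forall>x\<in>S. \<forall>y\<in>S. A (x + y) = A x + A y) \<and>
     (\<forall>c. \<forall>x\<in>S. A (c *\<^sub>R x) = c *\<^sub>R A x) \<and>
     (\<exists>C. \<forall>x\<in>S. norm (A x) \<le> norm x * C)"

definition is_transpose ::
  "'a::real_inner set \<Rightarrow> 'b::real_inner set \<Rightarrow> ('a \<Rightarrow> 'b) \<Rightarrow> ('b \<Rightarrow> 'a) \<Rightarrow> bool" where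
  "is_transpose S T A A' \<longleftrightarrow>
     bounded_operator T S A' \<and> (\<forall>x\<in>S. \<forall>y\<in>T. A x \<bullet> y = x \<bullet> A' y)"

text \<open>
  For a bounded operator between real Hilbert spaces the choice is determined on \<open>T\<close>
  (see \<open>is_transpose_unique\<close>), but not outside \<open>T\<close>.
\<close>

definition transpose_op ::
  "'a::real_inner set \<Rightarrow> 'b::real_inner set \<Rightarrow> ('a \<Rightarrow> 'b) \<Rightarrow> 'b \<Rightarrow> 'a" where
  "transpose_op S T A = (SOME A'. is_transpose S T A A')"

definition positive_operator :: "'a::real_inner set \<Rightarrow> ('a \<Rightarrow> 'a) \<Rightarrow> bool" where
  "positive_operator S P \<longleftrightarrow>
     bounded_operator S S P \<and> (\<forall>x\<in>S. transpose_op S S P x = P x) \<and> (\<forall>x\<in>S. 0 \<le> x \<bullet> P x)"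

definition invertible_operator :: "'a::real_inner set \<Rightarrow> ('a \<Rightarrow> 'a) \<Rightarrow> bool" where
  "invertible_operator S A \<longleftrightarrow>
     bounded_operator S S A \<and>
     (\<exists>C. bounded_operator S S C \<and> (\<forall>x\<in>S. C (A x) = x) \<and> (\<forall>x\<in>S. A (C x) = x))"

definition orthogonal_operator ::
  "'a::real_inner set \<Rightarrow> 'b::real_inner set \<Rightarrow> ('a \<Rightarrow> 'b) \<Rightarrow> bool" where
  "orthogonal_operator S T V \<longleftrightarrow>
     bounded_operator S T V \<and>
     (\<forall>x\<in>S. transpose_op S T V (V x) = x) \<and>
     (\<forall>y\<in>T. V (transpose_op S T V y) = y)"

definition skew_block :: "('a \<Rightarrow> 'a::real_inner) \<Rightarrow> 'a \<times> 'a \<Rightarrow> 'a \<times> 'a" where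
  "skew_block P = (\<lambda>(x, y). (- P y, P x))"

lemma is_transpose_unique:
  assumes S: "subspace S" and A: "is_transpose S T A A'" "is_transpose S T A A''" and y: "y \<in> T"
  shows "A' y = A'' y"
proof -
  have m: "A' y \<in> S" "A'' y \<in> S"
    using A y by (auto simp: is_transpose_def bounded_operator_def)
  then have d: "A' y - A'' y \<in> S"
    using S by (simp add: subspace_diff)
  have "x \<bullet> A' y = x \<bullet> A'' y" if "x \<in> S" for x
    using A y that by (metis is_transpose_def)
  from this[OF d] have "(A' y - A'' y) \<bullet> (A' y - A'' y) = 0"
    by (simp add: inner_diff_right)
  then show ?thesis by simp
qed

text \<open>On whole types the notions coincide with those of the library.\<close>

lemma bounded_operator_UNIV: "bounded_operator UNIV UNIV A \<longleftrightarrow> bounded_linear A"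
  by (auto simp: bounded_operator_def bounded_linear_def bounded_linear_axioms_def linear_iff)

lemma real_hilbert_space_UNIV: "real_hilbert_space (UNIV :: 'a::{real_inner, banach} set)"
  by (simp add: real_hilbert_space_def complete_UNIV)

lemma transpose_op_UNIV:
  assumes "bounded_linear A"
  shows "transpose_op UNIV UNIV A = adjoint A"
proof -
  have "bounded_linear A'" if A': "\<forall>x y. A x \<bullet> y = x \<bullet> A' y" for A'
  proof -
    obtain C where C: "\<And>x. norm (A x) \<le> norm x * C" "C \<ge> 0"
      using bounded_linear.nonneg_bounded[OF assms] by blast
    show ?thesis
    proof (rule bounded_linear_intro[where K = C])
      fix x y
      have "z \<bullet> A' (x + y) = z \<bullet> (A' x + A' y)" for z
        by (metis A' inner_add_right)
      then show "A' (x + y) = A' x + A' y"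
        by (metis vector_eq_ldot)
    next
      fix r x
      have "z \<bullet> A' (r *\<^sub>R x) = z \<bullet> (r *\<^sub>R A' x)" for z
        by (metis A' inner_scaleR_right)
      then show "A' (r *\<^sub>R x) = r *\<^sub>R A' x"
        by (metis vector_eq_ldot)
    next
      fix y
      have "norm (A' y) * norm (A' y) = A (A' y) \<bullet> y"
        using A' by (simp add: power2_norm_eq_inner flip: power2_eq_square)
      also have "\<dots> \<le> norm (A (A' y)) * norm y"
        by (rule norm_cauchy_schwarz)
      also have "\<dots> \<le> (norm (A' y) * C) * norm y"
        by (intro mult_right_mono C(1)) simp
      finally have "norm (A' y) * norm (A' y) \<le> norm (A' y) * (norm y * C)"
        by (simp add: mult_ac)
      then show "norm (A' y) \<le> norm y * C"
        using C(2) by (cases "norm (A' y) = 0") (auto simp: mult_le_cancel_left)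
    qed
  qed
  then have "is_transpose UNIV UNIV A = (\<lambda>A'. \<forall>x y. A x \<bullet> y = x \<bullet> A' y)"
    by (auto simp: fun_eq_iff is_transpose_def bounded_operator_UNIV)
  then show ?thesis
    by (simp add: transpose_op_def adjoint_def)
qed

end

theory Submission
  imports Defs
begin

text \<open>
  A skew invertible operator has a polar decomposition \<open>B = J S = S J\<close>, where \<open>S\<close> is the positive
  square root of \<open>B\<^sup>T B = - B\<^sup>2\<close> and \<open>J\<close> is a skew isometry with \<open>J\<^sup>2 = - 1\<close>
  (\<open>skew_polar_decomposition\<close>). So \<open>J\<close> makes \<open>H\<close> a complex Hilbert space on which \<open>S\<close> is complex
  linear, and what is needed is a real form of it that is invariant under \<open>S\<close>: a closed subspace
  \<open>K\<close> with \<open>S K \<subseteq> K\<close> and \<open>H = K \<oplus> J K\<close> orthogonally. Then \<open>(k, k') \<mapsto> k + J k'\<close> is an isometry of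
  \<open>K \<times> K\<close> onto \<open>H\<close>, its inverse is \<open>V\<close>, and
  \<open>B (k + J k') = J S k + S J\<^sup>2 k' = - S k' + J (S k)\<close> is the block form with \<open>P\<close> the restriction of
  \<open>S\<close> to \<open>K\<close>.

  The subspace \<open>K\<close> is found by Zorn's lemma in place of the spectral theorem. All the forms
  \<open>\<omega>\<^sub>n (x, y) = x \<bullet> J (S ^ n y)\<close> are alternating, because \<open>J\<close> is skew and commutes with the symmetric
  operator \<open>S\<close>. A set that is maximal among those on which all \<open>\<omega>\<^sub>n\<close> vanish is therefore equal to
  its own annihilator with respect to these forms. Hence it is a closed subspace, it is
  invariant under \<open>S\<close>, and by this invariance the form \<open>\<omega>\<^sub>0\<close> alone already determines it: \<open>K\<close> is the
  orthogonal complement of \<open>J K\<close> (\<open>invariant_lagrangian_exists\<close>). The projection theorem gives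
  \<open>H = K \<oplus> J K\<close>.

  The square root comes from a contraction (\<open>positive_square_root\<close>), and the projection theorem
  and the existence of adjoints from the Riesz representation theorem
  (\<open>riesz_representation_on_subspace\<close>).
\<close>

section \<open>Riesz representation and adjoints\<close>

text \<open>
  The representing vector minimises the quadratic functional \<open>x \<bullet> x - 2 * f x\<close> on \<open>M\<close>. By the
  parallelogram identity two near-minimisers are close to each other, so completeness supplies a
  minimiser, and the vanishing of the first variation there is the claimed identity. The
  subspace makes one argument serve two purposes: \<open>M = UNIV\<close> gives adjoints, and \<open>f = (\<bullet>) h\<close>
  gives the orthogonal projection of \<open>h\<close> to \<open>M\<close>.
\<close>

lemma riesz_representation_on_subspace:
  fixes f :: "'h::real_inner \<Rightarrow> real"
  assumes M: "real_hilbert_space M" and f: "bounded_linear f"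
  obtains m where "m \<in> M" "\<And>x. x \<in> M \<Longrightarrow> f x = m \<bullet> x"
proof -
  interpret f: bounded_linear f by (rule f)
  have sub: "subspace M" and compl: "complete M"
    using M by (auto simp: real_hilbert_space_def)
  define g where "g x = x \<bullet> x - 2 * f x" for x
  obtain C where C: "\<And>x. norm (f x) \<le> norm x * C"
    using f.bounded by blast
  have lower: "- (C\<^sup>2) \<le> g x" for x
  proof -
    have "f x \<le> norm x * C"
      using C[of x] by simp
    moreover have "0 \<le> (norm x - C)\<^sup>2" by simp
    ultimately show ?thesis
      by (simp add: g_def power2_diff flip: power2_norm_eq_inner)
  qed
  have bdd: "bdd_below (g ` M)"
    using lower by (auto simp: bdd_below_def)
  have ne: "g ` M \<noteq> {}"
    using subspace_0[OF sub] by auto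
  define d where "d = Inf (g ` M)"
  have d: "d \<le> g x" if "x \<in> M" for x
    unfolding d_def using that bdd by (intro cInf_lower) auto
  have "\<exists>u\<in>M. g u < d + inverse (real (Suc n))" for n
    using cInf_lessD[OF ne, of "d + inverse (real (Suc n))"] by (auto simp: d_def)
  then obtain u where u: "\<And>n. u n \<in> M" "\<And>n. g (u n) < d + inverse (real (Suc n))"
    by metis
  have close: "(norm (x - y))\<^sup>2 \<le> 2 * ((g x - d) + (g y - d))" if "x \<in> M" "y \<in> M" for x y
  proof -
    have "(1/2) *\<^sub>R (x + y) \<in> M"
      using that sub by (simp add: subspace_add subspace_scale)
    then have "d \<le> g ((1/2) *\<^sub>R (x + y))" by (rule d)
    moreover have "(norm (x - y))\<^sup>2 = 2 * (g x + g y - 2 * g ((1/2) *\<^sub>R (x + y)))"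
      by (simp add: g_def f.add f.scaleR power2_norm_eq_inner inner_simps inner_commute field_simps)
    ultimately show ?thesis by simp
  qed
  have "Cauchy u"
  proof (rule CauchyI)
    fix e :: real assume e: "0 < e"
    then obtain N where N: "inverse (real (Suc N)) < e\<^sup>2 / 4"
      using reals_Archimedean[of "e\<^sup>2 / 4"] by auto
    have "norm (u m - u n) < e" if "m \<ge> N" "n \<ge> N" for m n
    proof -
      have small: "g (u k) - d < e\<^sup>2 / 4" if "k \<ge> N" for k
      proof -
        have "inverse (real (Suc k)) \<le> inverse (real (Suc N))"
          using that by (intro le_imp_inverse_le) auto
        then show ?thesis using u(2)[of k] N by linarith
      qed
      have "(norm (u m - u n))\<^sup>2 < e\<^sup>2"
        using close[OF u(1) u(1), of m n] small[OF that(1)] small[OF that(2)] by argo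
      then show ?thesis
        using e by (simp add: power2_less_imp_less)
    qed
    then show "\<exists>N. \<forall>m\<ge>N. \<forall>n\<ge>N. norm (u m - u n) < e" by blast
  qed
  then obtain m where m: "m \<in> M" "u \<longlonglongrightarrow> m"
    using compl u(1) by (auto simp: complete_def)
  have "(\<lambda>n. g (u n)) \<longlonglongrightarrow> g m"
    unfolding g_def by (intro tendsto_intros m f.tendsto)
  moreover have "(\<lambda>n. d + inverse (real (Suc n))) \<longlonglongrightarrow> d + 0"
    by (intro tendsto_intros LIMSEQ_inverse_real_of_nat)
  ultimately have gm: "g m \<le> d"
    using LIMSEQ_le[of "\<lambda>n. g (u n)" "g m" _ "d + 0"] u(2) by (auto intro: less_imp_le)
  have "f x = m \<bullet> x" if x: "x \<in> M" for x
  proof -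
    define a b where "a = m \<bullet> x - f x" and "b = x \<bullet> x"
    have b: "0 \<le> b" by (simp add: b_def)
    \<comment> \<open>\<open>g (m + t *\<^sub>R x) - g m = 2 * a * t + b * t\<^sup>2\<close>; any small \<open>t\<close> of sign opposite to \<open>a\<close>
      makes it negative unless \<open>a = 0\<close>.\<close>
    define t where "t = - a / (1 + b)"
    have "m + t *\<^sub>R x \<in> M"
      using m x sub by (simp add: subspace_add subspace_scale)
    then have "g m \<le> g (m + t *\<^sub>R x)"
      using d gm by fastforce
    then have "0 \<le> 2 * a * t + b * t\<^sup>2"
      by (simp add: g_def f.add f.scaleR a_def b_def inner_simps inner_commute power2_eq_square
          algebra_simps)
    also have "\<dots> = - (2 + b) * (a / (1 + b))\<^sup>2"
      using b by (simp add: t_def power2_eq_square divide_simps) (simp add: algebra_simps)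
    finally have "(2 + b) * (a / (1 + b))\<^sup>2 \<le> 0"
      by (simp only: mult_minus_left neg_0_le_iff_le)
    then have "a = 0"
      using b by (simp add: mult_le_0_iff)
    then show ?thesis by (simp add: a_def)
  qed
  with m(1) that show ?thesis by blast
qed

text \<open>
  The constant \<open>adjoint\<close> is a choice among all operators with the adjoint property; the Riesz
  representation provides one, so the chosen operator has the property too.
\<close>

lemma adjoint_inner:
  fixes A :: "'h::{real_inner, banach} \<Rightarrow> 'k::real_inner"
  assumes "bounded_linear A"
  shows "A x \<bullet> y = x \<bullet> adjoint A y"
proof -
  have "\<exists>z. \<forall>x. A x \<bullet> y = x \<bullet> z" for y
  proof -
    have "bounded_linear (\<lambda>x. A x \<bullet> y)"
      using assms by (intro bounded_linear_inner_left_comp)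
    then obtain z where "\<And>x. A x \<bullet> y = z \<bullet> x"
      using riesz_representation_on_subspace[OF real_hilbert_space_UNIV] by (metis UNIV_I)
    then show ?thesis by (metis inner_commute)
  qed
  then have "\<exists>A'. \<forall>x y. A x \<bullet> y = x \<bullet> A' y" by metis
  then show ?thesis
    unfolding adjoint_def by (rule someI2_ex) blast
qed

lemma orthogonal_decomposition:
  fixes M :: "'h::real_inner set"
  assumes "real_hilbert_space M"
  obtains m where "m \<in> M" "\<And>x. x \<in> M \<Longrightarrow> (h - m) \<bullet> x = 0"
  using riesz_representation_on_subspace[OF assms bounded_linear_inner_right[of h]]
  by (metis inner_diff_left right_minus_eq)

section \<open>Square roots and the polar decomposition\<close>

text \<open>
  For small \<open>t > 0\<close> the operator \<open>A = 1 - t T\<close> has norm at most some \<open>q < 1\<close>, since \<open>T\<close> is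
  bounded below. Writing the root of \<open>t T\<close> as \<open>1 - Y\<close>, the equation \<open>(1 - Y)\<^sup>2 = 1 - A\<close> becomes
  \<open>Y = (A + Y\<^sup>2) / 2\<close>, whose right-hand side is a contraction of the ball of radius \<open>q\<close>. It maps
  to itself the closed set of those \<open>Y\<close> in the ball that are symmetric and commute with everything
  that commutes with \<open>T\<close>, so the fixed point has these properties as well.
\<close>

lemma positive_square_root:
  fixes T :: "'h::{real_inner, banach} \<Rightarrow> 'h"
  assumes T: "bounded_linear T" and sym: "\<And>x y. T x \<bullet> y = x \<bullet> T y"
    and c: "0 < c" "\<And>x. c * (x \<bullet> x) \<le> x \<bullet> T x"
  obtains S where "bounded_linear S" "\<And>x y. S x \<bullet> y = x \<bullet> S y" "\<And>x. 0 \<le> x \<bullet> S x"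
    "\<And>x. S (S x) = T x"
    "\<And>D x. bounded_linear D \<Longrightarrow> \<forall>x. D (T x) = T (D x) \<Longrightarrow> D (S x) = S (D x)"
proof -
  interpret T: bounded_linear T by (rule T)
  obtain M0 where M0: "0 < M0" "\<And>x. norm (T x) \<le> norm x * M0"
    using T.pos_bounded by blast
  \<comment> \<open>Adding \<open>c\<close> makes \<open>c < M\<close> hold even on the zero space, so that the root below is real.\<close>
  define M where "M = M0 + c"
  have M: "0 < M" "c < M" "\<And>x. norm (T x) \<le> norm x * M"
  proof -
    show "0 < M" "c < M" using M0 c by (auto simp: M_def)
    show "norm (T x) \<le> norm x * M" for x
      using order_trans[OF M0(2), of x "norm x * M"] c(1) by (simp add: M_def mult_left_mono)
  qed
  \<comment> \<open>The minimiser over \<open>t\<close> of \<open>1 - 2 * t * c + t\<^sup>2 * M\<^sup>2\<close>, a bound for the squared norm of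
    \<open>1 - t *\<^sub>R T\<close>.\<close>
  define t where "t = c / M\<^sup>2"
  define q where "q = sqrt (1 - c\<^sup>2 / M\<^sup>2)"
  have t: "0 < t" using c M by (simp add: t_def)
  have cM: "0 < c\<^sup>2 / M\<^sup>2" "c\<^sup>2 / M\<^sup>2 < 1"
    using c M by (auto simp: power_strict_mono)
  then have q: "0 \<le> q" "q < 1" "q\<^sup>2 = 1 - c\<^sup>2 / M\<^sup>2"
    unfolding q_def by (auto intro: less_imp_le)
  define A where "A = Blinfun (\<lambda>x. x - t *\<^sub>R T x)"
  have A: "A x = x - t *\<^sub>R T x" for x
    unfolding A_def
    by (subst bounded_linear_Blinfun_apply)
      (auto intro!: bounded_linear_intros bounded_linear_sub bounded_linear_const_scaleR T
        simp: bounded_linear_ident)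
  have normA: "norm A \<le> q"
  proof (rule norm_blinfun_bound[OF q(1)])
    fix x
    have "(norm (A x))\<^sup>2 = (norm x)\<^sup>2 - 2 * t * (x \<bullet> T x) + t\<^sup>2 * (norm (T x))\<^sup>2"
      unfolding A power2_norm_eq_inner
      by (simp add: inner_simps inner_commute power2_eq_square algebra_simps)
    also have "\<dots> \<le> (norm x)\<^sup>2 - 2 * t * (c * (norm x)\<^sup>2) + t\<^sup>2 * (norm x * M)\<^sup>2"
      using t c(2)[of x] M(3)[of x]
      by (intro add_mono diff_mono mult_left_mono power_mono) (auto simp: power2_norm_eq_inner)
    also have "\<dots> = (q * norm x)\<^sup>2"
      unfolding power_mult_distrib q(3) t_def
      using M(1) by (simp add: power2_eq_square field_simps)
    finally show "norm (A x) \<le> q * norm x"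
      by (rule power2_le_imp_le) (simp add: q)
  qed
  define X where "X = {Y :: 'h \<Rightarrow>\<^sub>L 'h. norm Y \<le> q} \<inter>
      {Y :: 'h \<Rightarrow>\<^sub>L 'h. \<forall>x y. Y x \<bullet> y = x \<bullet> Y y} \<inter>
      {Y :: 'h \<Rightarrow>\<^sub>L 'h. \<forall>D\<in>{D. bounded_linear D \<and> (\<forall>x. D (T x) = T (D x))}. \<forall>x. D (Y x) = Y (D x)}"
  define F where "F Y = (1/2) *\<^sub>R (A + (Y o\<^sub>L Y))" for Y :: "'h \<Rightarrow>\<^sub>L 'h"
  have F: "F Y x = (1/2) *\<^sub>R (A x + Y (Y x))" for Y x
    by (simp add: F_def blinfun.scaleR_left blinfun.add_left)
  have "\<exists>!Y\<in>X. F Y = Y"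
  proof (rule Banach_fix[where c = q])
    have cont: "continuous_on UNIV (\<lambda>Y :: 'h \<Rightarrow>\<^sub>L 'h. D (Y x))" if "bounded_linear D" for D x
      using bounded_linear_compose[OF that blinfun.bounded_linear_left]
      by (rule linear_continuous_on)
    have "X = {Y. norm Y \<le> q} \<inter> (\<Inter>x. \<Inter>y. {Y :: 'h \<Rightarrow>\<^sub>L 'h. Y x \<bullet> y = x \<bullet> Y y}) \<inter>
        (\<Inter>D\<in>{D. bounded_linear D \<and> (\<forall>x. D (T x) = T (D x))}. \<Inter>x. {Y :: 'h \<Rightarrow>\<^sub>L 'h. D (Y x) = Y (D x)})"
      unfolding X_def by blast
    moreover have "closed \<dots>"
      by (intro closed_Int closed_INT ballI closed_Collect_eq closed_Collect_le
          continuous_on_inner continuous_on_const continuous_on_norm_id cont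
          linear_continuous_on blinfun.bounded_linear_left) auto
    ultimately have "closed X" by simp
    then show "complete X" by (simp add: complete_eq_closed)
    have "0 \<in> X"
      using q by (auto simp: X_def linear_0 bounded_linear.linear)
    then show "X \<noteq> {}" by auto
    show "F ` X \<subseteq> X"
    proof safe
      fix Y assume Y: "Y \<in> X"
      have "norm (Y o\<^sub>L Y) \<le> norm Y * norm Y" by (rule norm_blinfun_compose)
      also have "\<dots> \<le> q * 1"
        using Y q by (intro mult_mono) (auto simp: X_def)
      finally have "norm (A + (Y o\<^sub>L Y)) \<le> q + q"
        using normA norm_triangle_ineq[of A "Y o\<^sub>L Y"] by linarith
      then have "norm (F Y) \<le> q" by (simp add: F_def)
      moreover have "F Y x \<bullet> y = x \<bullet> F Y y" for x y
        using Y by (simp add: X_def F A inner_simps sym)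
      moreover have "D (F Y x) = F Y (D x)"
        if "bounded_linear D" "\<forall>x. D (T x) = T (D x)" for D x
      proof -
        interpret D: bounded_linear D by fact
        show ?thesis
          using Y that by (simp add: X_def F A D.add D.diff D.scaleR)
      qed
      ultimately show "F Y \<in> X" by (simp add: X_def)
    qed
    show "dist (F Y) (F Z) \<le> q * dist Y Z" if "Y \<in> X" "Z \<in> X" for Y Z
    proof -
      have "F Y - F Z = (1/2) *\<^sub>R ((Y o\<^sub>L (Y - Z)) + ((Y - Z) o\<^sub>L Z))"
        by (rule blinfun_eqI) (simp add: F blinfun.diff_left blinfun.diff_right
            blinfun.scaleR_left blinfun.add_left algebra_simps)
      then have "norm (F Y - F Z) = (1/2) * norm ((Y o\<^sub>L (Y - Z)) + ((Y - Z) o\<^sub>L Z))" by simp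
      also have "\<dots> \<le> (1/2) * (norm Y * norm (Y - Z) + norm (Y - Z) * norm Z)"
        by (intro mult_left_mono norm_triangle_mono norm_blinfun_compose) simp
      also have "\<dots> \<le> (1/2) * (q * norm (Y - Z) + norm (Y - Z) * q)"
        using that by (intro mult_left_mono add_mono mult_right_mono) (auto simp: X_def)
      finally show ?thesis by (simp add: dist_norm mult.commute)
    qed
  qed (use q in auto)
  then obtain Y where Y: "Y \<in> X" "F Y = Y" by blast
  have Y2: "Y (Y x) = 2 *\<^sub>R Y x - A x" for x
  proof -
    have "2 *\<^sub>R Y x = 2 *\<^sub>R F Y x" by (simp only: Y(2))
    then show ?thesis by (simp add: F)
  qed
  define S where "S x = (1 / sqrt t) *\<^sub>R (x - Y x)" for x
  show ?thesis
  proof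
    show "bounded_linear S"
      unfolding S_def by (intro bounded_linear_const_scaleR bounded_linear_sub
          bounded_linear_ident blinfun.bounded_linear_right)
    show "S x \<bullet> y = x \<bullet> S y" for x y
      using Y(1) by (simp add: S_def X_def inner_simps)
    have "x \<bullet> Y x \<le> x \<bullet> x" for x
    proof -
      have "x \<bullet> Y x \<le> norm x * norm (Y x)" by (rule norm_cauchy_schwarz)
      also have "\<dots> \<le> norm x * (norm Y * norm x)"
        by (intro mult_left_mono norm_blinfun) simp
      also have "\<dots> \<le> norm x * (1 * norm x)"
        using Y(1) q(2) by (intro mult_left_mono mult_right_mono) (auto simp: X_def)
      finally show ?thesis by (simp add: power2_eq_square flip: power2_norm_eq_inner)
    qed
    then show "0 \<le> x \<bullet> S x" for x
      using t by (simp add: S_def inner_simps)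
    show "S (S x) = T x" for x
    proof -
      have "S (S x) = (1 / t) *\<^sub>R ((x - Y x) - (Y x - Y (Y x)))"
        using t by (simp add: S_def blinfun.scaleR_right blinfun.diff_right flip: scaleR_diff_right)
      also have "(x - Y x) - (Y x - Y (Y x)) = t *\<^sub>R T x"
        by (simp add: Y2 A scaleR_2)
      finally show ?thesis using t by simp
    qed
    show "D (S x) = S (D x)" if "bounded_linear D" "\<forall>x. D (T x) = T (D x)" for D x
    proof -
      interpret D: bounded_linear D by fact
      show ?thesis
        using Y(1) that by (simp add: X_def S_def D.diff D.scaleR)
    qed
  qed
qed

text \<open>
  \<open>S\<close> is the root of \<open>- B\<^sup>2\<close>, which is bounded below since \<open>B\<close> is. As \<open>S\<close> commutes with \<open>B\<close> and
  its inverse \<open>C\<close>, the isometry \<open>B S\<^sup>-\<^sup>1 = B S (S\<^sup>2)\<^sup>-\<^sup>1\<close> is \<open>- S C\<close>, so no inverse of \<open>S\<close> has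
  to be constructed to define \<open>J\<close>. The last equation shows that \<open>C J\<close> is that inverse.
\<close>

lemma skew_polar_decomposition:
  fixes B :: "'h::{real_inner, banach} \<Rightarrow> 'h"
  assumes B: "bounded_linear B" and skew: "\<And>x y. B x \<bullet> y = - (x \<bullet> B y)"
    and C: "bounded_linear C" "\<And>x. C (B x) = x" "\<And>x. B (C x) = x"
  obtains S J where "bounded_linear S" "\<And>x y. S x \<bullet> y = x \<bullet> S y" "\<And>x. 0 \<le> x \<bullet> S x"
    "bounded_linear J" "\<And>x y. J x \<bullet> y = - (x \<bullet> J y)" "\<And>x. J (J x) = - x"
    "\<And>x. J (S x) = B x" "\<And>x. S (J x) = B x" "\<And>x. S (C x) = - J x"
proof -
  interpret B: bounded_linear B by (rule B)
  interpret C: bounded_linear C by (rule C)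
  obtain m where m: "0 < m" "\<And>x. norm (C x) \<le> norm x * m"
    using C.pos_bounded by blast
  define T where "T x = - B (B x)" for x
  have "bounded_linear T"
    unfolding T_def by (intro bounded_linear_minus bounded_linear_compose[OF B B])
  moreover have "T x \<bullet> y = x \<bullet> T y" for x y
    by (simp add: T_def skew)
  moreover have "0 < 1 / m\<^sup>2" using m by simp
  moreover have "1 / m\<^sup>2 * (x \<bullet> x) \<le> x \<bullet> T x" for x
  proof -
    have "(norm x)\<^sup>2 \<le> (norm (B x) * m)\<^sup>2"
      using m(2)[of "B x"] by (intro power_mono) (auto simp: C)
    moreover have "x \<bullet> T x = (norm (B x))\<^sup>2"
      by (simp add: T_def power2_norm_eq_inner skew)
    ultimately show ?thesis
      using m(1) by (simp add: divide_le_eq power_mult_distrib flip: power2_norm_eq_inner)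
  qed
  ultimately obtain S where S: "bounded_linear S" "\<And>x y. S x \<bullet> y = x \<bullet> S y" "\<And>x. 0 \<le> x \<bullet> S x"
    "\<And>x. S (S x) = T x"
    and comm: "\<And>D x. bounded_linear D \<Longrightarrow> \<forall>x. D (T x) = T (D x) \<Longrightarrow> D (S x) = S (D x)"
    by (rule positive_square_root) blast
  interpret S: bounded_linear S by (rule S)
  have BS: "B (S x) = S (B x)" for x
    by (rule comm[OF B]) (simp add: T_def B.neg)
  have CS: "C (S x) = S (C x)" for x
    by (rule comm[OF C(1)]) (simp add: T_def C C.neg)
  have Cskew: "C x \<bullet> y = - (x \<bullet> C y)" for x y
    using skew[of "C x" "C y"] by (simp add: C)
  define J where "J x = - S (C x)" for x
  show ?thesis
  proof (rule that[of S J])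
    show "bounded_linear J"
      unfolding J_def by (intro bounded_linear_minus bounded_linear_compose[OF S(1) C(1)])
    show "J x \<bullet> y = - (x \<bullet> J y)" for x y
      by (simp add: J_def S(2) Cskew CS)
    show "J (J x) = - x" for x
      by (simp add: J_def C.neg S.neg CS S(4) T_def C)
    show "J (S x) = B x" for x
      by (simp add: J_def CS S(4) T_def C)
    show "S (J x) = B x" for x
      by (simp add: J_def S.neg S(4) T_def C)
    show "S (C x) = - J x" for x
      by (simp add: J_def)
  qed (use S in auto)
qed

section \<open>Invariant Lagrangian subspaces\<close>

text \<open>
  Isotropy is required for the forms of all powers of \<open>S\<close> because it is this that makes a maximal
  isotropic set invariant under \<open>S\<close>; a subspace that is maximal isotropic for \<open>J\<close> alone need not
  be invariant.
\<close>

definition isotropic :: "('h::real_inner \<Rightarrow> 'h) \<Rightarrow> ('h \<Rightarrow> 'h) \<Rightarrow> 'h set \<Rightarrow> bool" where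
  "isotropic J S X \<longleftrightarrow> (\<forall>x\<in>X. \<forall>y\<in>X. \<forall>n. x \<bullet> J ((S ^^ n) y) = 0)"

text \<open>
  Since the forms are alternating, a vector that annihilates a maximal isotropic set \<open>K\<close> can be
  adjoined to it and so already lies in it (\<open>mem\<close> below). This description of \<open>K\<close> by closed linear
  conditions gives everything else; for the last claim, invariance turns the conditions
  \<open>x \<bullet> J (S ^ n v) = 0\<close> into \<open>v \<bullet> J (S ^ n x) = 0\<close> with \<open>S ^ n x\<close> in \<open>K\<close>.
\<close>

lemma invariant_lagrangian_exists:
  fixes J S :: "'h::real_inner \<Rightarrow> 'h"
  assumes S: "bounded_linear S" "\<And>x y. S x \<bullet> y = x \<bullet> S y"
    and J: "bounded_linear J" "\<And>x y. J x \<bullet> y = - (x \<bullet> J y)"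
    and comm: "\<And>x. J (S x) = S (J x)"
  obtains K where "subspace K" "closed K" "\<And>x. x \<in> K \<Longrightarrow> S x \<in> K"
    "\<And>v. v \<in> K \<longleftrightarrow> (\<forall>x\<in>K. v \<bullet> J x = 0)"
proof -
  interpret S: bounded_linear S by (rule S)
  interpret J: bounded_linear J by (rule J)
  have Sn: "bounded_linear (S ^^ n)" for n
    by (induction n) (auto intro: bounded_linear_compose[OF S(1)] simp: o_def id_def bounded_linear_ident)
  have symn: "(S ^^ n) x \<bullet> y = x \<bullet> (S ^^ n) y" for n x y
    by (induction n arbitrary: x y) (auto simp: S(2) funpow_swap1)
  have commn: "J ((S ^^ n) x) = (S ^^ n) (J x)" for n x
    by (induction n) (auto simp: comm)
  have flip: "x \<bullet> J ((S ^^ n) y) = - (y \<bullet> J ((S ^^ n) x))" for n x y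
  proof -
    have "x \<bullet> J ((S ^^ n) y) = - (J x \<bullet> (S ^^ n) y)" by (simp add: J(2))
    also have "\<dots> = - (y \<bullet> J ((S ^^ n) x))" by (metis commn symn inner_commute)
    finally show ?thesis .
  qed
  have "\<exists>K\<in>Collect (isotropic J S). \<forall>X\<in>Collect (isotropic J S). K \<subseteq> X \<longrightarrow> X = K"
  proof (rule subset_Zorn')
    fix \<C> assume ch: "subset.chain (Collect (isotropic J S)) \<C>"
    have "x \<bullet> J ((S ^^ n) y) = 0" if "x \<in> X" "X \<in> \<C>" "y \<in> Y" "Y \<in> \<C>" for x y n X Y
    proof -
      have "X \<subseteq> Y \<or> Y \<subseteq> X" "isotropic J S X" "isotropic J S Y"
        using ch that by (auto simp: subset_chain_def)
      then show ?thesis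
        using that unfolding isotropic_def by blast
    qed
    then show "\<Union>\<C> \<in> Collect (isotropic J S)"
      by (auto simp: isotropic_def)
  qed
  then obtain K where K: "isotropic J S K" "\<And>X. isotropic J S X \<Longrightarrow> K \<subseteq> X \<Longrightarrow> X = K"
    by auto
  have mem: "v \<in> K \<longleftrightarrow> (\<forall>x\<in>K. \<forall>n. x \<bullet> J ((S ^^ n) v) = 0)" for v
  proof
    assume v: "\<forall>x\<in>K. \<forall>n. x \<bullet> J ((S ^^ n) v) = 0"
    moreover have "v \<bullet> J ((S ^^ n) v) = 0" for n
      using flip[of v n v] by simp
    moreover have "v \<bullet> J ((S ^^ n) x) = 0" if "x \<in> K" for n x
      using flip[of v n x] v that by simp
    ultimately have "isotropic J S (insert v K)"
      using K(1) by (simp add: isotropic_def)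
    then show "v \<in> K" using K(2) by blast
  qed (use K(1) in \<open>auto simp: isotropic_def\<close>)
  have lin: "linear (\<lambda>v. x \<bullet> J ((S ^^ n) v))" for x n
    by (intro bounded_linear.linear bounded_linear_inner_right_comp bounded_linear_compose[OF J(1) Sn])
  have inv: "S v \<in> K" if "v \<in> K" for v
  proof -
    have "x \<bullet> J ((S ^^ Suc n) v) = 0" if "x \<in> K" for x n
      using mem \<open>v \<in> K\<close> that by blast
    then show ?thesis
      unfolding mem[of "S v"] by (simp add: funpow_swap1)
  qed
  have invn: "(S ^^ n) v \<in> K" if "v \<in> K" for v n
    by (induction n) (auto simp: that inv)
  show ?thesis
  proof
    show "subspace K"
    proof (rule subspaceI)
      show "0 \<in> K"
        unfolding mem[of 0] by (simp add: linear_0[OF lin])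
      show "x + y \<in> K" if "x \<in> K" "y \<in> K" for x y
        using that unfolding mem[of "x + y"] mem[of x] mem[of y] by (simp add: linear_add[OF lin])
      show "c *\<^sub>R x \<in> K" if "x \<in> K" for c x
        using that unfolding mem[of "c *\<^sub>R x"] mem[of x] by (simp add: linear_cmul[OF lin])
    qed
    have "K = {v. \<forall>x\<in>K. \<forall>n. x \<bullet> J ((S ^^ n) v) = 0}"
      using mem by blast
    moreover have "closed \<dots>"
      unfolding Ball_def
      by (intro closed_Collect_all closed_Collect_imp open_Collect_const closed_Collect_eq
          continuous_on_inner continuous_on_const
          bounded_linear.continuous_on[OF J(1)] bounded_linear.continuous_on[OF Sn]
          continuous_on_id)
    ultimately show "closed K" by simp
    show "S x \<in> K" if "x \<in> K" for x using that by (rule inv)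
    show "v \<in> K \<longleftrightarrow> (\<forall>x\<in>K. v \<bullet> J x = 0)" for v
    proof
      assume "v \<in> K"
      then show "\<forall>x\<in>K. v \<bullet> J x = 0"
        using K(1) unfolding isotropic_def by (metis funpow_0)
    next
      assume v: "\<forall>x\<in>K. v \<bullet> J x = 0"
      then have "x \<bullet> J ((S ^^ n) v) = 0" if "x \<in> K" for x n
        using invn[OF that, of n] flip[of x n v] by simp
      then show "v \<in> K" using mem by blast
    qed
  qed
qed

text \<open>
  The orthogonal complement of \<open>J K\<close> is \<open>K\<close>, so this is the projection theorem for \<open>J K\<close>.
\<close>

lemma lagrangian_decomposition:
  fixes J :: "'h::{real_inner, banach} \<Rightarrow> 'h"
  assumes J: "bounded_linear J" "\<And>x. J (J x) = - x"
    and K: "subspace K" "closed K" "\<And>v. v \<in> K \<longleftrightarrow> (\<forall>x\<in>K. v \<bullet> J x = 0)"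
  obtains k k' where "k \<in> K" "k' \<in> K" "h = k + J k'"
proof -
  interpret J: bounded_linear J by (rule J)
  have "J w \<in> K \<longleftrightarrow> w \<in> J ` K" for w
  proof
    assume "J w \<in> K"
    then have "- J w \<in> K" using K(1) by (simp add: subspace_neg)
    moreover have "w = J (- J w)" by (simp add: J.neg J(2))
    ultimately show "w \<in> J ` K" by blast
  qed (use K(1) in \<open>auto simp: J(2) subspace_neg\<close>)
  then have "J ` K = J -` K" by blast
  \<comment> \<open>As \<open>J\<close> is its own inverse up to sign, \<open>J K\<close> is a preimage of a closed set.\<close>
  moreover have "closed (J -` K)"
    by (rule continuous_closed_vimage[OF K(2)]) (simp add: J.continuous_on linear_continuous_at J(1))
  moreover have "subspace (J ` K)"
    using J.linear K(1) by (rule linear_subspace_image)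
  ultimately have "real_hilbert_space (J ` K)"
    by (simp add: real_hilbert_space_def complete_eq_closed)
  from orthogonal_decomposition[OF this, of h]
  obtain w where w: "w \<in> J ` K" "\<And>x. x \<in> J ` K \<Longrightarrow> (h - w) \<bullet> x = 0"
    by blast
  then have "h - w \<in> K" using K(3) by blast
  moreover obtain k' where "k' \<in> K" "w = J k'" using w(1) by blast
  ultimately show ?thesis using that[of "h - w" k'] by simp
qed

section \<open>Operators on carriers\<close>

lemma transpose_op_eqI:
  assumes "subspace S" "is_transpose S T A A'" "y \<in> T"
  shows "transpose_op S T A y = A' y"
  unfolding transpose_op_def
  using assms by (metis is_transpose_unique someI)

lemma bounded_operator_restrict:
  assumes A: "bounded_linear A" and "\<And>x. x \<in> S \<Longrightarrow> A x \<in> T"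
  shows "bounded_operator S T A"
proof -
  interpret A: bounded_linear A by (rule A)
  show ?thesis
    using assms(2) A.bounded by (auto simp: bounded_operator_def A.add A.scaleR)
qed

lemma positive_operator_restrict:
  assumes "bounded_linear A" "\<And>x y. A x \<bullet> y = x \<bullet> A y" "\<And>x. 0 \<le> x \<bullet> A x"
    and "subspace K" "\<And>x. x \<in> K \<Longrightarrow> A x \<in> K"
  shows "positive_operator K A"
proof -
  have "bounded_operator K K A"
    using assms by (intro bounded_operator_restrict)
  moreover from this have "is_transpose K K A A"
    using assms(2) by (simp add: is_transpose_def)
  ultimately show ?thesis
    using assms(3,4) by (simp add: positive_operator_def transpose_op_eqI)
qed

text \<open>
  For an isometry \<open>W\<close> onto \<open>S\<close> the identity \<open>V x \<bullet> y = W (V x) \<bullet> W y = x \<bullet> W y\<close> exhibits \<open>W\<close> as the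
  transpose of any right inverse \<open>V\<close>. It also forces \<open>V\<close> to be linear, so that \<open>V\<close> may be obtained
  by choice.
\<close>

lemma inverse_isometry:
  assumes S: "subspace S" and T: "subspace T"
    and W: "bounded_operator T S W" "\<And>y z. y \<in> T \<Longrightarrow> z \<in> T \<Longrightarrow> W y \<bullet> W z = y \<bullet> z"
    and V: "\<And>x. x \<in> S \<Longrightarrow> V x \<in> T" "\<And>x. x \<in> S \<Longrightarrow> W (V x) = x"
  shows orthogonal_operator_inverse_isometry: "orthogonal_operator S T V"
    and transpose_inverse_isometry: "\<And>y. y \<in> T \<Longrightarrow> transpose_op S T V y = W y"
proof -
  have WS: "W y \<in> S" if "y \<in> T" for y
    using W(1) that by (simp add: bounded_operator_def)
  have adj: "V x \<bullet> y = x \<bullet> W y" if "x \<in> S" "y \<in> T" for x y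
    using W(2)[of "V x" y] V that by simp
  have eqI: "u = v" if "u \<in> T" "v \<in> T" "\<And>z. z \<in> T \<Longrightarrow> u \<bullet> z = v \<bullet> z" for u v
    using that(3)[of "u - v"] subspace_diff[OF T that(1,2)]
    by (metis inner_diff_left inner_eq_zero_iff right_minus_eq)
  have VW: "V (W y) = y" if "y \<in> T" for y
    using that by (intro eqI) (auto simp: V WS adj W(2))
  have "norm (V x) \<le> norm x * 1" if "x \<in> S" for x
    using W(2)[of "V x" "V x"] V that by (simp add: norm_eq_sqrt_inner)
  then have bd: "bounded_operator S T V"
    unfolding bounded_operator_def using V S T
    by (intro conjI ballI allI eqI)
      (auto simp: adj inner_simps subspace_add subspace_scale intro!: exI[of _ 1])
  have tr: "is_transpose S T V W"
    using W(1) adj by (simp add: is_transpose_def)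
  show eq: "\<And>y. y \<in> T \<Longrightarrow> transpose_op S T V y = W y"
    by (rule transpose_op_eqI[OF S tr])
  show "orthogonal_operator S T V"
    using bd V VW by (simp add: orthogonal_operator_def eq)
qed

theorem theorem3p4:
  fixes B :: "'h::{real_inner, banach} \<Rightarrow> 'h"
  assumes "bounded_linear B"
    and "adjoint B = (\<lambda>x. - B x)"
    and "invertible_operator UNIV B"
  shows "\<exists>(K :: 'h set) (P :: 'h \<Rightarrow> 'h) (V :: 'h \<Rightarrow> 'h \<times> 'h).
    real_hilbert_space K \<and>
    positive_operator K P \<and>
    invertible_operator K P \<and>
    orthogonal_operator UNIV (K \<times> K) V \<and>
    (\<forall>x. B x = transpose_op UNIV (K \<times> K) V (skew_block P (V x)))"
proof -
  have skew: "B x \<bullet> y = - (x \<bullet> B y)" for x y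
    using adjoint_inner[OF assms(1), of x y] assms(2) by simp
  obtain C where C: "bounded_linear C" "\<And>x. C (B x) = x" "\<And>x. B (C x) = x"
    using assms(3) by (auto simp: invertible_operator_def bounded_operator_UNIV)
  obtain S J where S: "bounded_linear S" "\<And>x y. S x \<bullet> y = x \<bullet> S y" "\<And>x. 0 \<le> x \<bullet> S x"
    and J: "bounded_linear J" "\<And>x y. J x \<bullet> y = - (x \<bullet> J y)" "\<And>x. J (J x) = - x"
    and JS: "\<And>x. J (S x) = B x" "\<And>x. S (J x) = B x" and SC: "\<And>x. S (C x) = - J x"
    by (rule skew_polar_decomposition[OF assms(1) skew C]) (rule that)
  interpret S: bounded_linear S by (rule S)
  interpret J: bounded_linear J by (rule J)
  have "J (S x) = S (J x)" for x by (simp add: JS)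
  from invariant_lagrangian_exists[OF S(1,2) J(1,2) this]
  obtain K where K: "subspace K" "closed K" "\<And>x. x \<in> K \<Longrightarrow> S x \<in> K"
    and lagr: "\<And>v. v \<in> K \<longleftrightarrow> (\<forall>x\<in>K. v \<bullet> J x = 0)"
    by blast
  have decomp: "\<exists>p\<in>K \<times> K. h = fst p + J (snd p)" for h
  proof (rule lagrangian_decomposition[OF J(1,3) K(1,2) lagr, of h])
    fix k k' assume "k \<in> K" "k' \<in> K" "h = k + J k'"
    then show ?thesis by (intro bexI[of _ "(k, k')"]) auto
  qed
  define W where "W p = fst p + J (snd p)" for p
  obtain V where V: "\<And>h. V h \<in> K \<times> K" "\<And>h. W (V h) = h"
    using decomp unfolding W_def by metis
  have KK: "subspace (K \<times> K)"
    using K(1) by (intro subspace_Times)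
  have "bounded_linear W"
    unfolding W_def by (intro bounded_linear_add bounded_linear_fst
        bounded_linear_compose[OF J(1) bounded_linear_snd])
  then have W: "bounded_operator (K \<times> K) UNIV W"
    by (intro bounded_operator_restrict) auto
  have iso: "W p \<bullet> W r = p \<bullet> r" if "p \<in> K \<times> K" "r \<in> K \<times> K" for p r
  proof -
    have "fst p \<in> K" "snd p \<in> K" "fst r \<in> K" "snd r \<in> K"
      using that by (simp_all add: mem_Times_iff)
    then have "fst p \<bullet> J (snd r) = 0" "fst r \<bullet> J (snd p) = 0" "snd p \<bullet> J (fst r) = 0"
      using lagr by blast+
    then show ?thesis
      by (simp add: W_def inner_simps inner_prod_def J(2,3) inner_commute[of "J _" "fst _"])
  qed
  note VW = inverse_isometry[OF subspace_UNIV KK W iso V]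
  \<comment> \<open>Invariance of \<open>K\<close> under the inverse \<open>C J\<close> of \<open>S\<close>: the component \<open>J k'\<close> of \<open>C (J x)\<close> is mapped
    by \<open>S\<close> into both \<open>J K\<close> and \<open>K\<close>, which are orthogonal, and so vanishes.\<close>
  have inv: "C (J x) \<in> K" if x: "x \<in> K" for x
  proof -
    obtain k k' where k: "k \<in> K" "k' \<in> K" "C (J x) = k + J k'"
      using decomp[of "C (J x)"] by auto
    have "S (C (J x)) = x" by (simp add: SC J(3))
    then have "J (S k') = x - S k"
      by (auto simp: k(3) S.add JS)
    then have "J (S k') \<in> K"
      using x k K by (simp add: subspace_diff)
    then have "J (S k') \<bullet> J (S k') = 0"
      using lagr k(2) K(3) by blast
    then have "B k' = 0" by (simp add: JS)
    then have "k' = 0" using C(2)[of k'] C(2)[of 0]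
      by (metis assms(1) linear_0 bounded_linear.linear)
    then show ?thesis using k by (simp add: J.zero)
  qed
  have "positive_operator K S"
    using S K by (intro positive_operator_restrict)
  moreover have "invertible_operator K S"
    unfolding invertible_operator_def
  proof (intro conjI exI ballI)
    show "bounded_operator K K S"
      using S K by (intro bounded_operator_restrict)
    show "bounded_operator K K (\<lambda>x. C (J x))"
      using inv by (intro bounded_operator_restrict bounded_linear_compose[OF C(1) J(1)])
  qed (simp_all add: JS C SC J(3))
  moreover have "B x = transpose_op UNIV (K \<times> K) V (skew_block S (V x))" for x
  proof -
    obtain k k' where k: "V x = (k, k')" "k \<in> K" "k' \<in> K"
      using V(1)[of x] by auto
    have "B x = J (S (W (V x)))" by (simp add: V JS)
    also have "\<dots> = J (S k) - S k'"
      using JS by (simp add: W_def k S.add J.add flip: J(3))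
    also have "\<dots> = W (skew_block S (V x))"
      by (simp add: k skew_block_def W_def)
    also have "\<dots> = transpose_op UNIV (K \<times> K) V (skew_block S (V x))"
      using k K by (intro VW(2)[symmetric]) (auto simp: skew_block_def subspace_neg)
    finally show ?thesis .
  qed
  ultimately show ?thesis
    using VW(1) K(1,2) by (intro exI[of _ K] exI[of _ S] exI[of _ V])
      (auto simp: real_hilbert_space_def complete_eq_closed)
qed

end
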